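(* Let $\mu$ and $\nu$ be two positive real numbers with $\mu<\nu$. Then the following inequalities hold: (1) $\left|\ln A(\mu,\nu)-\ln I(\mu,\nu)\right|\leq\dfrac{(\nu-\mu)^2}{48}\left[\max\left\{\dfrac{1}{\mu^2},\dfrac{4}{(\mu+\nu)^2}\right\}+\max\left\{\dfrac{1}{\nu^2},\dfrac{4}{(\mu+\nu)^2}\right\}\right]$; (2) $\left|\dfrac{2\ln A(\mu,\nu)+\ln G(\mu,\nu)}{3}-\ln I(\mu,\nu)\right|\leq\dfrac{(\nu-\mu)^2}{162}\left[\max\left\{\dfrac{1}{\mu^2},\dfrac{4}{(\mu+\nu)^2}\right\}+\max\left\{\dfrac{1}{\nu^2},\dfrac{4}{(\mu+\nu)^2}\right\}\right]$; (3) $\left|\dfrac{\ln A(\mu,\nu)+\ln G(\mu,\nu)}{2}-\ln I(\mu,\nu)\right|\leq\dfrac{(\nu-\mu)^2}{96}\left[\max\left\{\dfrac{1}{\mu^2},\dfrac{4}{(\mu+\nu)^2}\right\}+\max\left\{\dfrac{1}{\nu^2},\dfrac{4}{(\mu+\nu)^2}\right\}\right]$; (4) $\left|\ln G(\mu,\nu)-\ln I(\mu,\nu)\right|\leq\dfrac{(\nu-\mu)^2}{24}\left[\max\left\{\dfrac{1}{\mu^2},\dfrac{4}{(\mu+\nu)^2}\right\}+\max\left\{\dfrac{1}{\nu^2},\dfrac{4}{(\mu+\nu)^2}\right\}\right]$.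
   Context: For positive numbers $\mu\neq\nu$: the arithmetic mean is $A(\mu,\nu)=\frac{\mu+\nu}{2}$, the geometric mean is $G(\mu,\nu)=\sqrt{\mu\nu}$, and the identric mean is $I(\mu,\nu)=\frac{1}{e}\left(\frac{\nu^{\nu}}{\mu^{\mu}}\right)^{\frac{1}{\nu-\mu}}$. *)

theory Defs
  imports Complex_Main
begin

definition arith_mean :: "real \<Rightarrow> real \<Rightarrow> real" where
  "arith_mean \<mu> \<nu> = (\<mu> + \<nu>) / 2"

definition geom_mean :: "real \<Rightarrow> real \<Rightarrow> real" where
  "geom_mean \<mu> \<nu> = sqrt (\<mu> * \<nu>)"

(* Meaningful only for positive \<mu> \<noteq> \<nu>; on the diagonal the exponent
   1 / 0 = 0 gives the junk value 1 / e rather than the limit \<mu>. *)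
definition identric_mean :: "real \<Rightarrow> real \<Rightarrow> real" where
  "identric_mean \<mu> \<nu> = 1 / exp 1 * ((\<nu> powr \<nu>) / (\<mu> powr \<mu>)) powr (1 / (\<nu> - \<mu>))"

end

theory Submission
  imports Defs
begin

text \<open>
  With \<open>m = (\<mu> + \<nu>) / 2\<close>, the logarithm of the identric mean is the average of \<open>ln\<close> over
  \<open>[\<mu>, \<nu>]\<close>, while \<open>ln A = ln m\<close> and \<open>ln G = (ln \<mu> + ln \<nu>) / 2\<close>. So each of the four
  differences is the error of a symmetric three-point quadrature rule for \<open>ln\<close>, with weight
  \<open>\<theta>\<close> on the mean of the endpoint values and \<open>1 - \<theta>\<close> on the midpoint value: \<open>\<theta> = 0\<close> is
  the midpoint rule, \<open>1/3\<close> Simpson's rule, \<open>1/2\<close> the average of midpoint and trapezoid,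
  and \<open>1\<close> the trapezoid rule.

  On one half of the interval, of length \<open>h\<close>, integrating by parts twice writes the error as the
  integral of the kernel \<open>k s = s\<^sup>2/2 - \<theta> h s\<close> times the second derivative, where \<open>s\<close> is the
  distance from the outer endpoint, plus a boundary term in the first derivative at \<open>m\<close>. The
  boundary terms of the two halves cancel, and each integral is at most the integral of \<open>\<bar>k\<bar>\<close>
  times a bound for the second derivative (\<open>quadrature_error_half\<close>,
  \<open>quadrature_error_symmetric\<close>). The integral of \<open>\<bar>k\<bar>\<close> is \<open>h\<^sup>3\<close> times \<open>1/6\<close>, \<open>4/81\<close>, \<open>1/12\<close>,
  \<open>1/3\<close> for the four weights, which gives the constants 48, 162, 96 and 24.

  The second derivative of \<open>ln\<close> has absolute value \<open>1 / x\<^sup>2\<close>, which is decreasing, so on the two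
  halves it is at most \<open>1 / \<mu>\<^sup>2\<close> and \<open>1 / m\<^sup>2 = 4 / (\<mu> + \<nu>)\<^sup>2\<close>. These are the values of the two
  maxima.
\<close>

text \<open>
  Comparing derivatives stands in for comparing integrals; an explicit antiderivative of
  \<open>\<bar>k\<bar>\<close>, times the bound for the second derivative, will play the role of \<open>g\<close>.
\<close>

lemma abs_increment_le_of_derivative_le:
  fixes f g f' g' :: "real \<Rightarrow> real"
  assumes "a \<le> b"
    and f: "\<And>x. a \<le> x \<Longrightarrow> x \<le> b \<Longrightarrow> (f has_real_derivative f' x) (at x)"
    and g: "\<And>x. a \<le> x \<Longrightarrow> x \<le> b \<Longrightarrow> (g has_real_derivative g' x) (at x)"
    and le: "\<And>x. a \<le> x \<Longrightarrow> x \<le> b \<Longrightarrow> \<bar>f' x\<bar> \<le> g' x"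
  shows "\<bar>f b - f a\<bar> \<le> g b - g a"
proof -
  have "g a - f a \<le> g b - f b"
  proof (rule DERIV_nonneg_imp_nondecreasing[OF \<open>a \<le> b\<close>])
    fix x assume x: "a \<le> x" "x \<le> b"
    have "((\<lambda>x. g x - f x) has_real_derivative g' x - f' x) (at x)"
      using x by (intro DERIV_diff f g)
    with le[OF x] show "\<exists>y. ((\<lambda>x. g x - f x) has_real_derivative y) (at x) \<and> 0 \<le> y"
      by (intro exI[of _ "g' x - f' x"]) auto
  qed
  moreover have "g a + f a \<le> g b + f b"
  proof (rule DERIV_nonneg_imp_nondecreasing[OF \<open>a \<le> b\<close>])
    fix x assume x: "a \<le> x" "x \<le> b"
    have "((\<lambda>x. g x + f x) has_real_derivative g' x + f' x) (at x)"
      using x by (intro DERIV_add f g)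
    with le[OF x] show "\<exists>y. ((\<lambda>x. g x + f x) has_real_derivative y) (at x) \<and> 0 \<le> y"
      by (intro exI[of _ "g' x + f' x"]) auto
  qed
  ultimately show ?thesis by linarith
qed

text \<open>
  The integral of \<open>\<bar>s\<^sup>2/2 - \<theta> s\<bar>\<close> over \<open>[0, 1]\<close>, for \<open>\<theta> \<ge> 0\<close>. The kernel changes sign at
  \<open>2 \<theta>\<close>, which lies inside the interval only in the first case.
\<close>

definition kernel_mass :: "real \<Rightarrow> real" where
  "kernel_mass \<theta> = (if \<theta> \<le> 1/2 then 1/6 - \<theta>/2 + 4 * \<theta>^3 / 3 else \<theta>/2 - 1/6)"

text \<open>
  The function \<open>\<Phi>\<close> below collects the boundary terms of two integrations by parts, which makes its
  derivative the kernel times \<open>f''\<close>. The increment of \<open>\<Phi>\<close> is then estimated separately on the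
  intervals where the kernel has constant sign.
\<close>

lemma quadrature_error_half:
  fixes F f f' f'' :: "real \<Rightarrow> real"
  assumes "0 \<le> h" "0 \<le> \<theta>"
    and F: "\<And>s. 0 \<le> s \<Longrightarrow> s \<le> h \<Longrightarrow> (F has_real_derivative f s) (at s)"
    and f: "\<And>s. 0 \<le> s \<Longrightarrow> s \<le> h \<Longrightarrow> (f has_real_derivative f' s) (at s)"
    and f': "\<And>s. 0 \<le> s \<Longrightarrow> s \<le> h \<Longrightarrow> (f' has_real_derivative f'' s) (at s)"
    and M: "\<And>s. 0 \<le> s \<Longrightarrow> s \<le> h \<Longrightarrow> \<bar>f'' s\<bar> \<le> M"
  shows "\<bar>F h - F 0 - (1 - \<theta>) * h * f h - \<theta> * h * f 0 + (1/2 - \<theta>) * h\<^sup>2 * f' h\<bar>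
           \<le> kernel_mass \<theta> * h^3 * M"
proof -
  define k where "k s = s\<^sup>2 / 2 - \<theta> * h * s" for s
  define K where "K s = s^3 / 6 - \<theta> * h * s\<^sup>2 / 2" for s
  define \<Phi> where "\<Phi> s = F s - (s - \<theta> * h) * f s + k s * f' s" for s
  have \<Phi>': "(\<Phi> has_real_derivative k s * f'' s) (at s)" if s: "0 \<le> s" "s \<le> h" for s
  proof -
    have "(k has_real_derivative s - \<theta> * h) (at s)"
      unfolding k_def by (auto intro!: derivative_eq_intros)
    moreover have "((\<lambda>s. s - \<theta> * h) has_real_derivative 1) (at s)"
      by (auto intro!: derivative_eq_intros)
    ultimately show ?thesis
      unfolding \<Phi>_def
      by (auto intro!: derivative_eq_intros F[OF s] f[OF s] f'[OF s] simp: algebra_simps)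
  qed
  have K': "((\<lambda>s. c * K s) has_real_derivative c * k s) (at s)" for c s
    unfolding K_def k_def
    by (auto intro!: derivative_eq_intros simp: field_simps power2_eq_square)
  have pos: "\<bar>\<Phi> b - \<Phi> a\<bar> \<le> M * K b - M * K a"
    if ab: "0 \<le> a" "a \<le> b" "b \<le> h" and k: "\<And>s. a \<le> s \<Longrightarrow> s \<le> b \<Longrightarrow> 0 \<le> k s" for a b
  proof (rule abs_increment_le_of_derivative_le[OF \<open>a \<le> b\<close> \<Phi>' K'])
    fix s assume "a \<le> s" "s \<le> b"
    with ab k[of s] M[of s] have "k s * \<bar>f'' s\<bar> \<le> k s * M"
      by (intro mult_left_mono) auto
    with k[OF \<open>a \<le> s\<close> \<open>s \<le> b\<close>] show "\<bar>k s * f'' s\<bar> \<le> M * k s"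
      by (simp add: abs_mult mult.commute)
  qed (use ab in auto)
  have neg: "\<bar>\<Phi> b - \<Phi> a\<bar> \<le> (- M) * K b - (- M) * K a"
    if ab: "0 \<le> a" "a \<le> b" "b \<le> h" and k: "\<And>s. a \<le> s \<Longrightarrow> s \<le> b \<Longrightarrow> k s \<le> 0" for a b
  proof (rule abs_increment_le_of_derivative_le[OF \<open>a \<le> b\<close> \<Phi>' K'])
    fix s assume "a \<le> s" "s \<le> b"
    with ab k[of s] M[of s] have "- k s * \<bar>f'' s\<bar> \<le> - k s * M"
      by (intro mult_left_mono) auto
    with k[OF \<open>a \<le> s\<close> \<open>s \<le> b\<close>] show "\<bar>k s * f'' s\<bar> \<le> - M * k s"
      by (simp add: abs_mult mult.commute)
  qed (use ab in auto)
  have k_factor: "k s = s * (s - 2 * \<theta> * h) / 2" for s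
    by (simp add: k_def field_simps power2_eq_square)
  have k_neg: "k s \<le> 0" if "0 \<le> s" "s \<le> 2 * \<theta> * h" for s
    using that by (simp add: k_factor mult_nonneg_nonpos)
  have k_pos: "0 \<le> k s" if "0 \<le> s" "2 * \<theta> * h \<le> s" for s
    using that by (simp add: k_factor)
  have "\<bar>\<Phi> h - \<Phi> 0\<bar> \<le> kernel_mass \<theta> * h^3 * M"
  proof (cases "\<theta> \<le> 1/2")
    case True
    let ?r = "2 * \<theta> * h"
    have r: "0 \<le> ?r" "?r \<le> h"
      using assms(1,2) True mult_right_mono[of "2 * \<theta>" 1 h] by auto
    have "\<bar>\<Phi> ?r - \<Phi> 0\<bar> \<le> (- M) * K ?r - (- M) * K 0"
      using r by (intro neg k_neg) auto
    moreover have "\<bar>\<Phi> h - \<Phi> ?r\<bar> \<le> M * K h - M * K ?r"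
      using r by (intro pos k_pos) auto
    ultimately have "\<bar>\<Phi> h - \<Phi> 0\<bar> \<le> M * K h - 2 * M * K ?r + M * K 0"
      by linarith
    also have "\<dots> = kernel_mass \<theta> * h^3 * M"
      using True by (simp add: K_def kernel_mass_def field_simps power2_eq_square power3_eq_cube)
    finally show ?thesis .
  next
    case False
    have "h \<le> 2 * \<theta> * h"
      using assms(1) False mult_right_mono[of 1 "2 * \<theta>" h] by auto
    then have "\<bar>\<Phi> h - \<Phi> 0\<bar> \<le> (- M) * K h - (- M) * K 0"
      using assms(1) by (intro neg k_neg) auto
    also have "\<dots> = kernel_mass \<theta> * h^3 * M"
      using False by (simp add: K_def kernel_mass_def field_simps power2_eq_square power3_eq_cube)
    finally show ?thesis .
  qed
  moreover have "\<Phi> h - \<Phi> 0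
      = F h - F 0 - (1 - \<theta>) * h * f h - \<theta> * h * f 0 + (1/2 - \<theta>) * h\<^sup>2 * f' h"
    by (simp add: \<Phi>_def k_def field_simps power2_eq_square)
  ultimately show ?thesis by simp
qed

text \<open>
  Both halves are read inwards, from the outer endpoint to the midpoint. Reversing the direction on
  the right half flips the sign of the first derivative, so its values at the midpoint cancel.
\<close>

lemma quadrature_error_symmetric:
  fixes F f f' f'' :: "real \<Rightarrow> real"
  assumes "0 \<le> h" "0 \<le> \<theta>"
    and F: "\<And>x. m - h \<le> x \<Longrightarrow> x \<le> m + h \<Longrightarrow> (F has_real_derivative f x) (at x)"
    and f: "\<And>x. m - h \<le> x \<Longrightarrow> x \<le> m + h \<Longrightarrow> (f has_real_derivative f' x) (at x)"
    and f': "\<And>x. m - h \<le> x \<Longrightarrow> x \<le> m + h \<Longrightarrow> (f' has_real_derivative f'' x) (at x)"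
    and M: "\<And>x. m - h \<le> x \<Longrightarrow> x \<le> m \<Longrightarrow> \<bar>f'' x\<bar> \<le> M"
    and N: "\<And>x. m \<le> x \<Longrightarrow> x \<le> m + h \<Longrightarrow> \<bar>f'' x\<bar> \<le> N"
  shows "\<bar>F (m + h) - F (m - h) - 2 * (1 - \<theta>) * h * f m - \<theta> * h * (f (m - h) + f (m + h))\<bar>
           \<le> kernel_mass \<theta> * h^3 * (M + N)"
proof -
  have inc: "((\<lambda>s. g (m - h + s)) has_real_derivative g' (m - h + s)) (at s)"
    if "0 \<le> s" "s \<le> h"
      and "\<And>x. m - h \<le> x \<Longrightarrow> x \<le> m + h \<Longrightarrow> (g has_real_derivative g' x) (at x)"
    for g g' s
  proof -
    have "(g has_real_derivative g' (m - h + s)) (at (m - h + s))"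
      using that by auto
    moreover have "((\<lambda>s. m - h + s) has_real_derivative 1) (at s)"
      by (auto intro!: derivative_eq_intros)
    ultimately have "((\<lambda>s. g (m - h + s)) has_real_derivative g' (m - h + s) * 1) (at s)"
      by (rule DERIV_chain2)
    then show ?thesis by simp
  qed
  have dec: "((\<lambda>s. - g (m + h - s)) has_real_derivative g' (m + h - s)) (at s)"
    if "0 \<le> s" "s \<le> h"
      and "\<And>x. m - h \<le> x \<Longrightarrow> x \<le> m + h \<Longrightarrow> (g has_real_derivative g' x) (at x)"
    for g g' s
  proof -
    have "(g has_real_derivative g' (m + h - s)) (at (m + h - s))"
      using that by auto
    moreover have "((\<lambda>s. m + h - s) has_real_derivative - 1) (at s)"
      by (auto intro!: derivative_eq_intros)
    ultimately have "((\<lambda>s. g (m + h - s)) has_real_derivative g' (m + h - s) * - 1) (at s)"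
      by (rule DERIV_chain2)
    from DERIV_minus[OF this] show ?thesis by simp
  qed
  have "\<bar>F (m - h + h) - F (m - h + 0) - (1 - \<theta>) * h * f (m - h + h) - \<theta> * h * f (m - h + 0)
          + (1/2 - \<theta>) * h\<^sup>2 * f' (m - h + h)\<bar> \<le> kernel_mass \<theta> * h^3 * M"
    by (rule quadrature_error_half[where F = "\<lambda>s. F (m - h + s)" and f = "\<lambda>s. f (m - h + s)"
          and f' = "\<lambda>s. f' (m - h + s)" and f'' = "\<lambda>s. f'' (m - h + s)"])
       (use assms(1,2) in \<open>auto intro!: inc F f f' M\<close>)
  then have left: "\<bar>F m - F (m - h) - (1 - \<theta>) * h * f m - \<theta> * h * f (m - h)
          + (1/2 - \<theta>) * h\<^sup>2 * f' m\<bar> \<le> kernel_mass \<theta> * h^3 * M"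
    by simp
  have "((\<lambda>s. f (m + h - s)) has_real_derivative - f' (m + h - s)) (at s)"
    if "0 \<le> s" "s \<le> h" for s
    using DERIV_minus[OF dec[OF that f]] by simp
  then have "\<bar>- F (m + h - h) - - F (m + h - 0) - (1 - \<theta>) * h * f (m + h - h)
          - \<theta> * h * f (m + h - 0) + (1/2 - \<theta>) * h\<^sup>2 * - f' (m + h - h)\<bar>
        \<le> kernel_mass \<theta> * h^3 * N"
    using assms(1,2)
    by (intro quadrature_error_half[where F = "\<lambda>s. - F (m + h - s)" and f = "\<lambda>s. f (m + h - s)"
          and f' = "\<lambda>s. - f' (m + h - s)" and f'' = "\<lambda>s. f'' (m + h - s)"])
       (auto intro!: dec F f' N)
  then have right: "\<bar>F (m + h) - F m - (1 - \<theta>) * h * f m - \<theta> * h * f (m + h)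
          - (1/2 - \<theta>) * h\<^sup>2 * f' m\<bar> \<le> kernel_mass \<theta> * h^3 * N"
    by simp
  have "F (m + h) - F (m - h) - 2 * (1 - \<theta>) * h * f m - \<theta> * h * (f (m - h) + f (m + h))
      = (F m - F (m - h) - (1 - \<theta>) * h * f m - \<theta> * h * f (m - h) + (1/2 - \<theta>) * h\<^sup>2 * f' m)
      + (F (m + h) - F m - (1 - \<theta>) * h * f m - \<theta> * h * f (m + h) - (1/2 - \<theta>) * h\<^sup>2 * f' m)"
    by (simp add: algebra_simps)
  then have "\<bar>F (m + h) - F (m - h) - 2 * (1 - \<theta>) * h * f m - \<theta> * h * (f (m - h) + f (m + h))\<bar>
      \<le> kernel_mass \<theta> * h^3 * M + kernel_mass \<theta> * h^3 * N"
    using left right by linarith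
  then show ?thesis by (simp only: distrib_left)
qed

text \<open>The right-hand side is the average of \<open>ln\<close> over \<open>[\<mu>, \<nu>]\<close>.\<close>

lemma ln_identric_mean:
  assumes "0 < \<mu>" "0 < \<nu>" "\<mu> \<noteq> \<nu>"
  shows "ln (identric_mean \<mu> \<nu>) = ((\<nu> * ln \<nu> - \<nu>) - (\<mu> * ln \<mu> - \<mu>)) / (\<nu> - \<mu>)"
proof -
  have "ln (identric_mean \<mu> \<nu>) = (\<nu> * ln \<nu> - \<mu> * ln \<mu>) / (\<nu> - \<mu>) - 1"
    using assms by (simp add: identric_mean_def ln_mult ln_div ln_powr)
  with assms show ?thesis by (simp add: field_simps)
qed

lemma ln_geom_mean:
  assumes "0 < \<mu>" "0 < \<nu>"
  shows "ln (geom_mean \<mu> \<nu>) = (ln \<mu> + ln \<nu>) / 2"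
  using assms by (simp add: geom_mean_def ln_sqrt ln_mult)

text \<open>
  The symmetric rule is applied to \<open>ln\<close>, with antiderivative \<open>x ln x - x\<close>, and divided by the
  length \<open>2 h = \<nu> - \<mu>\<close> of the interval; the factor \<open>h\<^sup>3 / (2 h)\<close> that remains is \<open>(\<nu> - \<mu>)\<^sup>2 / 8\<close>.
\<close>

lemma ln_means_error:
  assumes "0 < \<mu>" "\<mu> < \<nu>" "0 \<le> \<theta>"
  shows "\<bar>(1 - \<theta>) * ln (arith_mean \<mu> \<nu>) + \<theta> * ln (geom_mean \<mu> \<nu>) - ln (identric_mean \<mu> \<nu>)\<bar>
    \<le> kernel_mass \<theta> * ((\<nu> - \<mu>)\<^sup>2 / 8) *
      (max (1 / \<mu>\<^sup>2) (4 / (\<mu> + \<nu>)\<^sup>2) + max (1 / \<nu>\<^sup>2) (4 / (\<mu> + \<nu>)\<^sup>2))"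
proof -
  define m where "m = (\<mu> + \<nu>) / 2"
  define h where "h = (\<nu> - \<mu>) / 2"
  have mh: "m - h = \<mu>" "m + h = \<nu>" by (simp_all add: m_def h_def field_simps)
  have h: "0 < h" and m: "\<mu> < m" "m < \<nu>" using assms by (simp_all add: h_def m_def)
  have m2: "4 / (\<mu> + \<nu>)\<^sup>2 = 1 / m\<^sup>2" by (simp add: m_def power_divide)
  have recip_mono: "1 / y\<^sup>2 \<le> 1 / x\<^sup>2" if "0 < x" "x \<le> y" for x y :: real
    using that by (intro divide_left_mono power_mono) auto
  have maxes: "max (1 / \<mu>\<^sup>2) (1 / m\<^sup>2) = 1 / \<mu>\<^sup>2" "max (1 / \<nu>\<^sup>2) (1 / m\<^sup>2) = 1 / m\<^sup>2"
    using recip_mono[of \<mu> m] recip_mono[of m \<nu>] m assms by (simp_all add: max_def)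
  let ?F = "\<lambda>x::real. x * ln x - x"
  let ?D = "(1 - \<theta>) * ln (arith_mean \<mu> \<nu>) + \<theta> * ln (geom_mean \<mu> \<nu>) - ln (identric_mean \<mu> \<nu>)"
  have "\<bar>?F (m + h) - ?F (m - h) - 2 * (1 - \<theta>) * h * ln m - \<theta> * h * (ln (m - h) + ln (m + h))\<bar>
          \<le> kernel_mass \<theta> * h^3 * (1 / \<mu>\<^sup>2 + 1 / m\<^sup>2)"
  proof (rule quadrature_error_symmetric[where f' = "\<lambda>x. 1 / x" and f'' = "\<lambda>x. - (1 / x\<^sup>2)"])
    fix x assume "m - h \<le> x" "x \<le> m + h"
    then have "0 < x" using mh assms by simp
    then show "(?F has_real_derivative ln x) (at x)"
      and "(ln has_real_derivative 1 / x) (at x)"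
      and "((\<lambda>x. 1 / x) has_real_derivative - (1 / x\<^sup>2)) (at x)"
      by (auto intro!: derivative_eq_intros simp: power2_eq_square)
  qed (use h assms mh m recip_mono in auto)
  also have "?F (m + h) - ?F (m - h) - 2 * (1 - \<theta>) * h * ln m - \<theta> * h * (ln (m - h) + ln (m + h))
      = - (2 * h) * ?D"
  proof -
    have "2 * h = \<nu> - \<mu>" by (simp add: h_def)
    then have I: "ln (identric_mean \<mu> \<nu>) = (?F \<nu> - ?F \<mu>) / (2 * h)"
      using ln_identric_mean[of \<mu> \<nu>] assms mh by simp
    have A: "arith_mean \<mu> \<nu> = m" by (simp add: arith_mean_def m_def)
    have G: "ln (geom_mean \<mu> \<nu>) = (ln \<mu> + ln \<nu>) / 2"
      using assms by (intro ln_geom_mean) auto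
    show ?thesis
      unfolding mh I A G using h by (simp add: field_simps)
  qed
  also have "\<bar>- (2 * h) * ?D\<bar> = (2 * h) * \<bar>?D\<bar>"
    using h by (simp only: abs_mult)
  also have "kernel_mass \<theta> * h^3 * S = (2 * h) * (kernel_mass \<theta> * (h\<^sup>2 / 2) * S)" for S
    by (simp add: power2_eq_square power3_eq_cube)
  finally have "\<bar>?D\<bar> \<le> kernel_mass \<theta> * (h\<^sup>2 / 2) * (1 / \<mu>\<^sup>2 + 1 / m\<^sup>2)"
    using h by (subst (asm) mult_le_cancel_left_pos) auto
  moreover have "h\<^sup>2 / 2 = (\<nu> - \<mu>)\<^sup>2 / 8"
    by (simp add: h_def power_divide)
  ultimately show ?thesis
    by (simp only: m2 maxes)
qed

theorem proposition16:
  fixes \<mu> \<nu> :: real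
  assumes "0 < \<mu>" and "0 < \<nu>" and "\<mu> < \<nu>"
  shows "\<bar>ln (arith_mean \<mu> \<nu>) - ln (identric_mean \<mu> \<nu>)\<bar>
          \<le> (\<nu> - \<mu>)\<^sup>2 / 48 *
            (max (1 / \<mu>\<^sup>2) (4 / (\<mu> + \<nu>)\<^sup>2) + max (1 / \<nu>\<^sup>2) (4 / (\<mu> + \<nu>)\<^sup>2))
       \<and> \<bar>(2 * ln (arith_mean \<mu> \<nu>) + ln (geom_mean \<mu> \<nu>)) / 3 - ln (identric_mean \<mu> \<nu>)\<bar>
          \<le> (\<nu> - \<mu>)\<^sup>2 / 162 *
            (max (1 / \<mu>\<^sup>2) (4 / (\<mu> + \<nu>)\<^sup>2) + max (1 / \<nu>\<^sup>2) (4 / (\<mu> + \<nu>)\<^sup>2))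
       \<and> \<bar>(ln (arith_mean \<mu> \<nu>) + ln (geom_mean \<mu> \<nu>)) / 2 - ln (identric_mean \<mu> \<nu>)\<bar>
          \<le> (\<nu> - \<mu>)\<^sup>2 / 96 *
            (max (1 / \<mu>\<^sup>2) (4 / (\<mu> + \<nu>)\<^sup>2) + max (1 / \<nu>\<^sup>2) (4 / (\<mu> + \<nu>)\<^sup>2))
       \<and> \<bar>ln (geom_mean \<mu> \<nu>) - ln (identric_mean \<mu> \<nu>)\<bar>
          \<le> (\<nu> - \<mu>)\<^sup>2 / 24 *
            (max (1 / \<mu>\<^sup>2) (4 / (\<mu> + \<nu>)\<^sup>2) + max (1 / \<nu>\<^sup>2) (4 / (\<mu> + \<nu>)\<^sup>2))"
proof -
  note error = ln_means_error[OF assms(1,3)]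
  have mass: "kernel_mass 0 = 1/6" "kernel_mass (1/3) = 4/81"
    "kernel_mass (1/2) = 1/12" "kernel_mass 1 = 1/3"
    by (simp_all add: kernel_mass_def power3_eq_cube)
  have simpson: "(1 - 1/3) * x + 1/3 * y = (2 * x + y) / 3" for x y :: real
    by (simp add: field_simps)
  have average: "(1 - 1/2) * x + 1/2 * y = (x + y) / 2" for x y :: real
    by (simp add: field_simps)
  have scale: "4/81 * (x / 8) = x / 162" "1/12 * (x / 8) = x / 96" for x :: real
    by simp_all
  show ?thesis
    using error[of 0] error[of "1/3"] error[of "1/2"] error[of 1]
    unfolding mass simpson average scale by simp
qed

end
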